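(* Let $X$ be a real Hilbert space, let $A$ and $B$ be maximally monotone operators on $X$, let $T=T_{(A,B)}$ be the Douglas–Rachford splitting operator of $(A,B)$, and let $w\in X$. Define the operators $A_w\colon x\mapsto A(x-w)$, $B^w\colon x\mapsto Bx-w$, and $T_{-w}\colon x\mapsto T(x+w)$, and set $Z_w=(A_w+B^w)^{-1}(0)$. Then $$Z_w=J_{B^w}\big(\operatorname{Fix}T_{-w}\big)=J_B\big(w+\{x\in X : x=T(x+w)\}\big).$$ Furthermore, the following are equivalent: (i) $Z_w\neq\varnothing$; (ii) $\operatorname{Fix}T_{-w}\neq\varnothing$; (iii) $w\in\operatorname{ran}(\operatorname{Id}-T)$; (iv) $w\in\operatorname{ran}(A_w+B)$.
   Context: Operators on $X$ may be set-valued. The resolvent of a maximally monotone operator $A$ is $J_A=(\operatorname{Id}+A)^{-1}$ (single-valued, defined on all of $X$) and the reflected resolvent is $R_A=2J_A-\operatorname{Id}$. The Douglas–Rachford splitting operator of the ordered pair $(A,B)$ is $T_{(A,B)}=J_AR_B+\operatorname{Id}-J_B\colon X\to X$. $\operatorname{Fix}S=\{x\in X : Sx=x\}$ for $S\colon X\to X$. The operators $A_w$ and $B^w$ are again maximally monotone. Here $Bx-w=\{u-w : u\in Bx\}$. *)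

theory Defs
  imports "HOL-Analysis.Analysis"
begin

type_synonym 'a operator = "'a \<Rightarrow> 'a set"

definition op_sum :: "'a::plus operator \<Rightarrow> 'a operator \<Rightarrow> 'a operator" where
  "op_sum A B = (\<lambda>x. {u + v |u v. u \<in> A x \<and> v \<in> B x})"

definition op_inverse :: "'a operator \<Rightarrow> 'a operator" where
  "op_inverse A = (\<lambda>u. {x. u \<in> A x})"

definition op_ran :: "'a operator \<Rightarrow> 'a set" where
  "op_ran A = (\<Union>x. A x)"

definition op_Id :: "'a operator" where
  "op_Id = (\<lambda>x. {x})"

definition monotone_operator :: "'a::real_inner operator \<Rightarrow> bool" where
  "monotone_operator A \<longleftrightarrow>
     (\<forall>x y. \<forall>u\<in>A x. \<forall>v\<in>A y. inner (x - y) (u - v) \<ge> 0)"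

definition maximally_monotone :: "'a::real_inner operator \<Rightarrow> bool" where
  "maximally_monotone A \<longleftrightarrow> monotone_operator A \<and>
     (\<forall>C. monotone_operator C \<and> (\<forall>x. A x \<subseteq> C x) \<longrightarrow> C = A)"

text \<open>For a maximally monotone operator on a Hilbert space, \<open>(Id + A)\<inverse>\<close> takes exactly one
  value at every point (Minty's theorem), so the description operator below picks that value.
  For other operators the result may be unspecified.\<close>

definition resolvent :: "'a::real_inner operator \<Rightarrow> 'a \<Rightarrow> 'a" where
  "resolvent A x = (THE y. y \<in> op_inverse (op_sum op_Id A) x)"

definition reflected_resolvent :: "'a::real_inner operator \<Rightarrow> 'a \<Rightarrow> 'a" where
  "reflected_resolvent A x = 2 *\<^sub>R resolvent A x - x"

definition douglas_rachford :: "'a::real_inner operator \<Rightarrow> 'a operator \<Rightarrow> 'a \<Rightarrow> 'a" where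
  "douglas_rachford A B x = resolvent A (reflected_resolvent B x) + x - resolvent B x"

definition Fix :: "('a \<Rightarrow> 'a) \<Rightarrow> 'a set" where
  "Fix S = {x. S x = x}"

definition inner_shift :: "'a::minus operator \<Rightarrow> 'a \<Rightarrow> 'a operator" where
  "inner_shift A w = (\<lambda>x. A (x - w))"

definition outer_shift :: "'a::minus operator \<Rightarrow> 'a \<Rightarrow> 'a operator" where
  "outer_shift B w = (\<lambda>x. {u - w |u. u \<in> B x})"

end

theory Submission
  imports Defs
begin

text \<open>
  Unfolding the shifts, a point \<open>z\<close> lies in \<open>Z\<^sub>w\<close> exactly when some \<open>b \<in> B z\<close> satisfies
  \<open>w - b \<in> A (z - w)\<close>. Put \<open>x = z + b - w\<close>. Then \<open>b \<in> B z\<close> says that \<open>J\<^sub>B (x + w) = z\<close>, so that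
  \<open>R\<^sub>B (x + w) = z - b\<close>, and \<open>w - b \<in> A (z - w)\<close> says that \<open>J\<^sub>A (z - b) = z - w\<close>; together these give
  \<open>T (x + w) = x\<close>. Each step can be reversed, and this is the description of \<open>Z\<^sub>w\<close> by fixed points
  (lemma \<open>shifted_zero_iff_fixed_point\<close>). Since moreover \<open>J\<close> of the outer shift of \<open>B\<close> by \<open>w\<close> is
  \<open>x \<mapsto> J\<^sub>B (x + w)\<close>, the equivalent conditions differ only by translations by \<open>w\<close>.

  The reversal rests on \<open>J\<^sub>A\<close> and \<open>J\<^sub>B\<close> being defined everywhere, which is Minty's theorem: \<open>Id + A\<close> is
  onto if \<open>A\<close> is maximally monotone. It is proved here by way of the Fitzpatrick function \<open>F\<close> of the
  graph of \<open>A\<close>, a closed convex function on the product of the space with itself which lies above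
  the duality product \<open>(x, u) \<mapsto> \<langle>x, u\<rangle>\<close> and agrees with it on the graph. The function
  \<open>F(z) + \<parallel>z\<parallel>\<^sup>2 / 2\<close> is nonnegative and strongly convex, so completeness provides a minimizer
  \<open>(x, u)\<close>. Strong convexity, read at the points of the graph, says that \<open>(-u, -x)\<close> is monotonically
  related to the graph, hence belongs to it; read at \<open>(-u, -x)\<close> itself, it gives \<open>u = -x\<close>. So
  \<open>-x \<in> A x\<close>, that is, \<open>0\<close> is in the range of \<open>Id + A\<close>; other values follow by translation.
\<close>

section \<open>Minimizing a closed convex function plus half the squared norm\<close>

text \<open>The parallelogram law for an arbitrary point of the segment: it measures exactly how far the
  squared norm is from being affine.\<close>

lemma norm_square_convex_combination:
  fixes x y :: "'a::real_inner"
  shows "(norm ((1 - t) *\<^sub>R x + t *\<^sub>R y))\<^sup>2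
           = (1 - t) * (norm x)\<^sup>2 + t * (norm y)\<^sup>2 - t * (1 - t) * (norm (x - y))\<^sup>2"
  unfolding power2_norm_eq_inner
  by (simp add: inner_add_left inner_add_right inner_diff_left inner_diff_right
      inner_commute[of y x] algebra_simps)

text \<open>A convex function, possibly with infinite values, is represented by its epigraph \<open>K\<close>. Any two
  almost minimal points are close, because their midpoint would otherwise fall below the infimum;
  so minimizing sequences converge, although balls need not be compact. The quadratic growth at the
  minimizer comes from comparing it with points of the segment to \<open>z\<close> that tend to it.\<close>

lemma strongly_convex_minimizer:
  fixes K :: "('h::{real_inner, complete_space} \<times> real) set"
  assumes "closed K" and "convex K" and "K \<noteq> {}"
    and bounded: "\<And>z r. (z, r) \<in> K \<Longrightarrow> l \<le> r + (norm z)\<^sup>2 / 2"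
  obtains z0 r0 where "(z0, r0) \<in> K"
    and "\<And>z r. (z, r) \<in> K \<Longrightarrow>
           r0 + (norm z0)\<^sup>2 / 2 + (norm (z - z0))\<^sup>2 / 2 \<le> r + (norm z)\<^sup>2 / 2"
proof -
  define q :: "'h \<times> real \<Rightarrow> real" where "q p = snd p + (norm (fst p))\<^sup>2 / 2" for p
  define m where "m = Inf (q ` K)"
  have bdd: "bdd_below (q ` K)"
    using bounded by (intro bdd_belowI[of _ l]) (auto simp: q_def)
  have m_le: "m \<le> q p" if "p \<in> K" for p
    unfolding m_def using bdd that by (intro cInf_lower) auto
  have q_segment: "q ((1 - t) *\<^sub>R p + t *\<^sub>R p')
      = (1 - t) * q p + t * q p' - t * (1 - t) * (norm (fst p - fst p'))\<^sup>2 / 2" for t p p'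
  proof -
    have "(1 - t) * a + t * b + ((1 - t) * c + t * d - t * (1 - t) * e) / 2
        = (1 - t) * (a + c / 2) + t * (b + d / 2) - t * (1 - t) * e / 2" for a b c d e :: real
      by (simp add: algebra_simps add_divide_distrib diff_divide_distrib)
    then show ?thesis
      by (simp only: q_def fst_add snd_add fst_scaleR snd_scaleR real_scaleR_def
          norm_square_convex_combination)
  qed
  have segment: "(1 - t) *\<^sub>R p + t *\<^sub>R p' \<in> K" if "p \<in> K" "p' \<in> K" "0 \<le> t" "t \<le> 1" for t p p'
    using \<open>convex K\<close> that by (simp add: convex_alt)

  have "\<exists>p\<in>K. q p < m + inverse (real (Suc n))" for n
    using cInf_lessD[of "q ` K" "m + inverse (real (Suc n))"] \<open>K \<noteq> {}\<close> by (auto simp: m_def)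
  then obtain p where pK: "\<And>n. p n \<in> K" and p_less: "\<And>n. q (p n) < m + inverse (real (Suc n))"
    by metis
  have close: "(norm (fst (p i) - fst (p j)))\<^sup>2 \<le> 4 * (inverse (real (Suc i)) + inverse (real (Suc j)))" for i j
    using m_le[OF segment[OF pK[of i] pK[of j], of "1/2"]] q_segment[of "1/2" "p i" "p j"]
      p_less[of i] p_less[of j]
    by simp
  have "Cauchy (\<lambda>n. fst (p n))"
  proof (rule CauchyI)
    fix e :: real
    assume "0 < e"
    then obtain N where N: "inverse (real (Suc N)) < e\<^sup>2 / 8"
      using reals_Archimedean[of "e\<^sup>2 / 8"] by auto
    have small: "inverse (real (Suc n)) < e\<^sup>2 / 8" if "N \<le> n" for n
    proof -
      have "inverse (real (Suc n)) \<le> inverse (real (Suc N))"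
        using that by (simp add: field_simps)
      then show ?thesis
        using N by linarith
    qed
    have "norm (fst (p i) - fst (p j)) < e" if "N \<le> i" "N \<le> j" for i j
    proof -
      have "(norm (fst (p i) - fst (p j)))\<^sup>2 < e\<^sup>2"
        using close[of i j] small[OF that(1)] small[OF that(2)] unfolding distrib_left by linarith
      then show ?thesis
        using \<open>0 < e\<close> by (simp add: power2_less_imp_less)
    qed
    then show "\<exists>M. \<forall>i\<ge>M. \<forall>j\<ge>M. norm (fst (p i) - fst (p j)) < e"
      by blast
  qed
  then obtain z0 where z0: "(\<lambda>n. fst (p n)) \<longlonglongrightarrow> z0"
    using Cauchy_convergent_iff convergent_def by blast
  have "(\<lambda>n. q (p n)) \<longlonglongrightarrow> m"
  proof (rule tendsto_sandwich[of "\<lambda>_. m" _ _ "\<lambda>n. m + inverse (real (Suc n))"])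
    show "(\<lambda>n. m + inverse (real (Suc n))) \<longlonglongrightarrow> m"
      using tendsto_add[OF tendsto_const[of m] LIMSEQ_inverse_real_of_nat]
      by simp
    show "\<forall>\<^sub>F n in sequentially. q (p n) \<le> m + inverse (real (Suc n))"
      using p_less by (intro always_eventually allI less_imp_le)
  qed (use m_le pK in auto)
  then have "(\<lambda>n. q (p n) - (norm (fst (p n)))\<^sup>2 / 2) \<longlonglongrightarrow> m - (norm z0)\<^sup>2 / 2"
    using z0 by (intro tendsto_intros) auto
  then have r0: "(\<lambda>n. snd (p n)) \<longlonglongrightarrow> m - (norm z0)\<^sup>2 / 2"
    by (simp add: q_def)
  define p0 where "p0 = (z0, m - (norm z0)\<^sup>2 / 2)"
  have "p0 \<in> K"
    using closed_sequentially[OF \<open>closed K\<close>, of p p0] pK tendsto_Pair[OF z0 r0]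
    by (simp add: p0_def)
  have "q p0 = m"
    by (simp add: q_def p0_def)
  have growth: "m + (norm (fst p' - z0))\<^sup>2 / 2 \<le> q p'" if "p' \<in> K" for p'
  proof -
    define d where "d = (norm (z0 - fst p'))\<^sup>2 / 2"
    have "(1 - t) * d \<le> q p' - m" if t: "0 < t" "t < 1" for t
    proof -
      have "m \<le> (1 - t) * m + t * q p' - t * (1 - t) * d"
        using m_le[OF segment[OF \<open>p0 \<in> K\<close> \<open>p' \<in> K\<close>, of t]] q_segment[of t p0 p'] t
          \<open>q p0 = m\<close>
        by (simp add: d_def p0_def)
      then have "t * ((1 - t) * d) \<le> t * (q p' - m)"
        by (simp add: algebra_simps)
      then show ?thesis
        using t by simp
    qed
    then have "\<forall>\<^sub>F t in at_right 0. (1 - t) * d \<le> q p' - m"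
      unfolding eventually_at_right_field using zero_less_one by blast
    moreover have "((\<lambda>t. (1 - t) * d) \<longlongrightarrow> (1 - 0) * d) (at_right (0::real))"
      by (intro tendsto_intros)
    ultimately have "d \<le> q p' - m"
      by (simp add: tendsto_upperbound)
    then show ?thesis
      by (simp add: d_def norm_minus_commute)
  qed
  show thesis
  proof (rule that)
    show "(z0, m - (norm z0)\<^sup>2 / 2) \<in> K"
      using \<open>p0 \<in> K\<close> by (simp add: p0_def)
    show "m - (norm z0)\<^sup>2 / 2 + (norm z0)\<^sup>2 / 2 + (norm (z - z0))\<^sup>2 / 2 \<le> r + (norm z)\<^sup>2 / 2"
      if "(z, r) \<in> K" for z r
      using growth[OF that] by (simp add: q_def)
  qed
qed

section \<open>Minty's theorem\<close>

text \<open>Maximality quantifies over all extensions of the graph; only the one by the single pair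
  \<open>(x, u)\<close> is ever compared with \<open>A\<close>.\<close>

lemma maximally_monotone_memI:
  assumes "maximally_monotone A"
    and related: "\<And>y v. v \<in> A y \<Longrightarrow> 0 \<le> inner (x - y) (u - v)"
  shows "u \<in> A x"
proof -
  define C where "C = A(x := insert u (A x))"
  have mono: "monotone_operator A"
    using assms(1) by (simp add: maximally_monotone_def)
  have swap: "0 \<le> inner (y - x) (v - u)" if "v \<in> A y" for y v
    using related[OF that] inner_minus_left[of "x - y" "v - u"] inner_minus_right[of "x - y" "u - v"]
    by simp
  have "monotone_operator C"
    using mono related swap unfolding monotone_operator_def C_def by (auto split: if_splits)
  moreover have "\<forall>y. A y \<subseteq> C y"
    by (auto simp: C_def)
  ultimately have "C = A"
    using assms(1) by (simp add: maximally_monotone_def)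
  then show ?thesis
    by (metis C_def fun_upd_same insertI1)
qed

text \<open>The value \<open>0\<close> of Minty's theorem, for a graph \<open>G\<close> rather than an operator, so that it can be
  translated easily. The set \<open>K\<close> in the proof is the epigraph of the Fitzpatrick function
  \<open>(x, u) \<mapsto> sup {\<langle>x, v\<rangle> + \<langle>y, u\<rangle> - \<langle>y, v\<rangle> | (y, v) \<in> G}\<close>, an intersection of half-spaces.\<close>

lemma maximal_monotone_graph_meets_antidiagonal:
  fixes G :: "('a::{real_inner, complete_space} \<times> 'a) set"
  assumes mono: "\<And>x u y v. (x, u) \<in> G \<Longrightarrow> (y, v) \<in> G \<Longrightarrow> 0 \<le> inner (x - y) (u - v)"
    and maximal: "\<And>x u. (\<And>y v. (y, v) \<in> G \<Longrightarrow> 0 \<le> inner (x - y) (u - v)) \<Longrightarrow> (x, u) \<in> G"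
  shows "\<exists>x. (x, - x) \<in> G"
proof -
  define K where "K = (\<Inter>g\<in>G. {p. inner ((snd g, fst g), - 1 :: real) p \<le> inner (fst g) (snd g)})"
  have K_iff: "((x, u), r) \<in> K \<longleftrightarrow> (\<forall>(y, v)\<in>G. inner x v + inner y u - inner y v \<le> r)" for x u r
    by (auto simp: K_def inner_commute algebra_simps)
  have graph_in_K: "((x, u), inner x u) \<in> K" if "(x, u) \<in> G" for x u
    using mono[OF that] by (auto simp: K_iff inner_diff_left inner_diff_right algebra_simps)
  \<comment> \<open>The Fitzpatrick function dominates the duality product: off the graph, maximality supplies a
    pair whose affine function is already larger.\<close>
  have above: "inner x u \<le> r" if xur: "((x, u), r) \<in> K" for x u r
  proof (rule ccontr)
    assume "\<not> inner x u \<le> r"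
    then have "inner x v + inner y u - inner y v \<le> inner x u" if "(y, v) \<in> G" for y v
      using xur that by (force simp: K_iff)
    then have "(x, u) \<in> G"
      by (intro maximal) (simp add: inner_diff_left inner_diff_right algebra_simps)
    then show False
      using xur \<open>\<not> inner x u \<le> r\<close> by (force simp: K_iff)
  qed
  have norm_pair: "(norm (x, u))\<^sup>2 = (norm x)\<^sup>2 + (norm u)\<^sup>2" for x u :: 'a
    by (simp add: norm_Pair)
  have square: "(norm (x + u))\<^sup>2 = (norm x)\<^sup>2 + (norm u)\<^sup>2 + 2 * inner x u" for x u :: 'a
    unfolding power2_norm_eq_inner
    by (simp add: inner_add_left inner_add_right inner_commute[of u x])
  have nonneg: "0 \<le> r + (norm z)\<^sup>2 / 2" if "(z, r) \<in> K" for z r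
  proof -
    obtain x u where z: "z = (x, u)"
      by (cases z)
    have "0 \<le> (norm (x + u))\<^sup>2"
      by simp
    then show ?thesis
      using above[of x u r] that square[of x u] norm_pair[of x u] unfolding z by linarith
  qed
  have "closed K"
    unfolding K_def by (intro closed_INT ballI closed_halfspace_le)
  moreover have "convex K"
    unfolding K_def by (intro convex_INT convex_halfspace_le)
  moreover have "K \<noteq> {}"
    using graph_in_K maximal by blast
  ultimately obtain z0 r0 where "(z0, r0) \<in> K"
    and least: "\<And>z r. (z, r) \<in> K \<Longrightarrow>
           r0 + (norm z0)\<^sup>2 / 2 + (norm (z - z0))\<^sup>2 / 2 \<le> r + (norm z)\<^sup>2 / 2"
    using strongly_convex_minimizer[of K 0] nonneg by blast
  obtain x u where z0: "z0 = (x, u)"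
    by (cases z0)
  \<comment> \<open>The minimal value is nonnegative; after expanding the squares, the growth inequality at the
    graph point \<open>(y, v)\<close> compares the pair \<open>(-u, -x)\<close> with \<open>(y, v)\<close>.\<close>
  have gap: "(norm (x + u))\<^sup>2 / 2 \<le> inner (- u - y) (- x - v)" if yv: "(y, v) \<in> G" for y v
  proof -
    have "(norm z0)\<^sup>2 + (norm ((y, v) - z0))\<^sup>2
        = (norm (y, v))\<^sup>2 + 2 * (norm z0)\<^sup>2 - 2 * inner y x - 2 * inner v u"
      unfolding power2_norm_eq_inner
      by (simp add: z0 inner_diff_left inner_diff_right inner_commute[of x y]
          inner_commute[of u v])
    then have "(norm z0)\<^sup>2 / 2 - inner y x - inner v u \<le> inner y v"
      using least[OF graph_in_K[OF yv]] nonneg[OF \<open>(z0, r0) \<in> K\<close>] by linarith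
    moreover have "inner (- u - y) (- x - v) = inner y v + inner y x + inner v u + inner x u"
      by (simp add: inner_diff_left inner_diff_right inner_commute algebra_simps)
    ultimately show ?thesis
      using square[of x u] norm_pair[of x u] unfolding z0 by linarith
  qed
  have "(- u, - x) \<in> G"
  proof (rule maximal)
    show "0 \<le> inner (- u - y) (- x - v)" if "(y, v) \<in> G" for y v
      using gap[OF that] by (rule order_trans[rotated]) simp
  qed
  from gap[OF this] have "x + u = 0"
    by simp
  then have "u = - x"
    by (simp add: eq_neg_iff_add_eq_0 add.commute)
  then show ?thesis
    using \<open>(- u, - x) \<in> G\<close> by auto
qed

theorem Minty:
  fixes A :: "'a::{real_inner, complete_space} \<Rightarrow> 'a set"
  assumes "maximally_monotone A"
  shows "\<exists>y. x - y \<in> A y"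
proof -
  define G where "G = {(y, v). v + x \<in> A y}"
  have "\<exists>y. (y, - y) \<in> G"
  proof (rule maximal_monotone_graph_meets_antidiagonal)
    show "0 \<le> inner (y - y') (v - v')" if "(y, v) \<in> G" "(y', v') \<in> G" for y v y' v'
    proof -
      have "0 \<le> inner (y - y') ((v + x) - (v' + x))"
        using assms that unfolding maximally_monotone_def monotone_operator_def G_def by blast
      then show ?thesis
        by simp
    qed
    show "(y, v) \<in> G" if related: "\<And>y' v'. (y', v') \<in> G \<Longrightarrow> 0 \<le> inner (y - y') (v - v')" for y v
    proof -
      have "v + x \<in> A y"
      proof (rule maximally_monotone_memI[OF assms])
        show "0 \<le> inner (y - y') (v + x - v')" if "v' \<in> A y'" for y' v'
          using related[of y' "v' - x"] that by (simp add: G_def algebra_simps)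
      qed
      then show ?thesis
        by (simp add: G_def)
    qed
  qed
  then show ?thesis
    by (auto simp: G_def)
qed

section \<open>Resolvents and the Douglas--Rachford operator\<close>

lemma mem_op_inverse_Id_plus: "y \<in> op_inverse (op_sum op_Id A) x \<longleftrightarrow> x - y \<in> A y"
  for x :: "'a::ab_group_add"
  by (auto simp: op_inverse_def op_sum_def op_Id_def intro: exI[of _ "x - y"])

lemma resolvent_eq_iff:
  fixes A :: "'a::{real_inner, complete_space} \<Rightarrow> 'a set"
  assumes "maximally_monotone A"
  shows "resolvent A x = y \<longleftrightarrow> x - y \<in> A y"
proof -
  have unique: "y = y'" if "x - y \<in> A y" "x - y' \<in> A y'" for y y'
  proof -
    have "0 \<le> inner (y - y') ((x - y) - (x - y'))"
      using assms that unfolding maximally_monotone_def monotone_operator_def by blast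
    then have "inner (y - y') (y - y') \<le> 0"
      using inner_minus_right[of "y - y'" "y - y'"] by simp
    then have "inner (y - y') (y - y') = 0"
      using inner_ge_zero by (rule antisym)
    then show ?thesis
      by simp
  qed
  with Minty[OF assms] have "\<exists>!y. x - y \<in> A y"
    by (rule ex_ex1I)
  then have "x - resolvent A x \<in> A (resolvent A x)"
    unfolding resolvent_def mem_op_inverse_Id_plus by (rule theI')
  then show ?thesis
    using unique by blast
qed

lemma resolvent_outer_shift: "resolvent (outer_shift B w) x = resolvent B (x + w)"
proof -
  have "x - y \<in> outer_shift B w y \<longleftrightarrow> x + w - y \<in> B y" for y
    by (auto simp: outer_shift_def algebra_simps intro: exI[of _ "x + w - y"])
  then show ?thesis
    unfolding resolvent_def mem_op_inverse_Id_plus by simp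
qed

lemma mem_shifted_zeros_iff:
  "z \<in> op_inverse (op_sum (inner_shift A w) (outer_shift B w)) 0
     \<longleftrightarrow> (\<exists>b\<in>B z. w - b \<in> A (z - w))" for z :: "'a::ab_group_add"
proof -
  have "0 = a + (b - w) \<longleftrightarrow> a = w - b" for a b
    by (auto simp: algebra_simps)
  then show ?thesis
    by (auto simp: op_inverse_def op_sum_def inner_shift_def outer_shift_def)
qed

text \<open>The correspondence is \<open>x + w = z + b\<close>, where \<open>b \<in> B z\<close> witnesses that \<open>z\<close> is a zero.\<close>

lemma shifted_zero_iff_fixed_point:
  fixes A B :: "'a::{real_inner, complete_space} \<Rightarrow> 'a set"
  assumes A: "maximally_monotone A" and B: "maximally_monotone B"
  shows "(\<exists>b\<in>B z. w - b \<in> A (z - w))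
     \<longleftrightarrow> (\<exists>x. douglas_rachford A B (x + w) = x \<and> resolvent B (x + w) = z)"
proof -
  have key: "douglas_rachford A B (x + w) = x \<longleftrightarrow> w - (x + w - z) \<in> A (z - w)"
    if z: "resolvent B (x + w) = z" for x
  proof -
    have "douglas_rachford A B (x + w) = x \<longleftrightarrow> resolvent A (2 *\<^sub>R z - (x + w)) = z - w"
      unfolding douglas_rachford_def reflected_resolvent_def z
      by (auto simp: algebra_simps)
    also have "\<dots> \<longleftrightarrow> 2 *\<^sub>R z - (x + w) - (z - w) \<in> A (z - w)"
      by (rule resolvent_eq_iff[OF A])
    also have "2 *\<^sub>R z - (x + w) - (z - w) = w - (x + w - z)"
      by (simp add: scaleR_2)
    finally show ?thesis .
  qed
  show ?thesis
  proof
    assume "\<exists>b\<in>B z. w - b \<in> A (z - w)"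
    then obtain b where b: "b \<in> B z" "w - b \<in> A (z - w)"
      by blast
    define x where "x = z + b - w"
    have xw: "x + w - z = b"
      by (simp add: x_def)
    then have "resolvent B (x + w) = z"
      using b by (simp add: resolvent_eq_iff[OF B])
    then show "\<exists>x. douglas_rachford A B (x + w) = x \<and> resolvent B (x + w) = z"
      using key[of x] b unfolding xw by blast
  next
    assume "\<exists>x. douglas_rachford A B (x + w) = x \<and> resolvent B (x + w) = z"
    then show "\<exists>b\<in>B z. w - b \<in> A (z - w)"
      using key resolvent_eq_iff[OF B] by blast
  qed
qed

theorem proposition3p3:
  fixes A B :: "'a::{real_inner, complete_space} \<Rightarrow> 'a set" and w :: 'a
  assumes "maximally_monotone A" and "maximally_monotone B"
  shows "let T = douglas_rachford A B;
             A\<^sub>w = inner_shift A w;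
             B\<^sub>w = outer_shift B w;
             T\<^sub>w = (\<lambda>x. T (x + w));
             Z\<^sub>w = op_inverse (op_sum A\<^sub>w B\<^sub>w) 0
         in Z\<^sub>w = resolvent B\<^sub>w ` Fix T\<^sub>w
          \<and> resolvent B\<^sub>w ` Fix T\<^sub>w = resolvent B ` ((+) w ` {x. x = T (x + w)})
          \<and> (Z\<^sub>w \<noteq> {} \<longleftrightarrow> Fix T\<^sub>w \<noteq> {})
          \<and> (Fix T\<^sub>w \<noteq> {} \<longleftrightarrow> w \<in> range (\<lambda>x. x - T x))
          \<and> (w \<in> range (\<lambda>x. x - T x) \<longleftrightarrow> w \<in> op_ran (op_sum A\<^sub>w B))"
proof -
  define T where "T = douglas_rachford A B"
  define F where "F = Fix (\<lambda>x. T (x + w))"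
  define Z where "Z = op_inverse (op_sum (inner_shift A w) (outer_shift B w)) 0"
  have mem_F: "x \<in> F \<longleftrightarrow> T (x + w) = x" for x
    by (simp add: F_def Fix_def)
  have Z_eq: "Z = resolvent (outer_shift B w) ` F"
  proof (rule set_eqI)
    show "z \<in> Z \<longleftrightarrow> z \<in> resolvent (outer_shift B w) ` F" for z
      using shifted_zero_iff_fixed_point[OF assms, of z w]
      by (auto simp: Z_def mem_shifted_zeros_iff mem_F T_def resolvent_outer_shift)
  qed
  have image_eq: "resolvent (outer_shift B w) ` F = resolvent B ` ((+) w ` {x. x = T (x + w)})"
  proof -
    have "F = {x. x = T (x + w)}"
      by (auto simp: mem_F)
    then show ?thesis
      by (simp add: image_image resolvent_outer_shift add.commute)
  qed
  have ran_T: "F \<noteq> {} \<longleftrightarrow> w \<in> range (\<lambda>x. x - T x)"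
  proof
    assume "F \<noteq> {}"
    then obtain x where "T (x + w) = x"
      by (auto simp: mem_F)
    then have "w = (x + w) - T (x + w)"
      by simp
    then show "w \<in> range (\<lambda>x. x - T x)"
      by (rule range_eqI)
  next
    assume "w \<in> range (\<lambda>x. x - T x)"
    then obtain x where "w = x - T x"
      by blast
    then have "x - w \<in> F"
      by (simp add: mem_F)
    then show "F \<noteq> {}"
      by blast
  qed
  have "w \<in> op_ran (op_sum (inner_shift A w) B) \<longleftrightarrow> (\<exists>z. \<exists>b\<in>B z. w - b \<in> A (z - w))"
  proof -
    have "w = a + b \<longleftrightarrow> a = w - b" for a b :: 'a
      by (auto simp: algebra_simps)
    then show ?thesis
      by (auto simp: op_ran_def op_sum_def inner_shift_def)
  qed
  then have ran_sum: "w \<in> op_ran (op_sum (inner_shift A w) B) \<longleftrightarrow> Z \<noteq> {}"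
    unfolding Z_def ex_in_conv[symmetric] mem_shifted_zeros_iff by simp
  have "Z \<noteq> {} \<longleftrightarrow> F \<noteq> {}"
    by (simp add: Z_eq)
  then show ?thesis
    unfolding Let_def T_def[symmetric] F_def[symmetric] Z_def[symmetric]
    using Z_eq image_eq ran_T ran_sum by blast
qed

end
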